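(* Let $\sigma>0$, $s\ge1$, $\gamma>1$ and $\delta\in(0,1)$. Both SF-PATE algorithms (SF$_S$-PATE, with voting set $\mathcal C=\mathcal A$, and SF$_T$-PATE, with voting set $\mathcal C=\mathcal Y$), run with voting noise of standard deviation $\sigma$ and a student dataset $\bar D$ of $s$ samples, satisfy $$\left(\frac{s\gamma}{\sigma^2}+\frac{\log(1/\delta)}{\gamma-1},\ \delta\right)\text{-differential privacy}$$ with respect to the group attribute $A$.
   Context: A dataset of size $n$ is a pair $(D_P,D_S)$ with public part $D_P=((X_j,Y_j))_{j\in[n]}\in(\mathcal X\times\mathcal Y)^n$ and group part $D_S=(A_j)_{j\in[n]}\in\mathcal A^n$, where $\mathcal A=[m]$ and $\mathcal Y$ is a finite label set. $D_S\sim D_S'$ (adjacent) means they differ in at most one entry. A randomized mechanism $\mathcal M$ is $(\epsilon,\delta)$-differentially private with respect to attribute $A$ if for every $D_P$, all adjacent $D_S\sim D_S'$, and every (measurable) output set $R$, $$\Pr(\mathcal M(D_P,D_S)\in R)\le e^{\epsilon}\Pr(\mathcal M(D_P,D_S')\in R)+\delta .$$ SF-PATE algorithms. Fix a partition $[n]=I_1\sqcup\dots\sqcup I_K$ and let $\bar D\subseteq D_P$ consist of $s$ public samples (no group attributes). For each $i\in[K]$, a teacher $\mathcal M^{(i)}:\mathcal X\to\mathcal C$ is trained by an arbitrary deterministic rule on the portion $D_i=((X_j,A_j,Y_j))_{j\in I_i}$ only. In SF$_S$-PATE, $\mathcal C=\mathcal A$ (teachers predict group attributes); in SF$_T$-PATE,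 $\mathcal C=\mathcal Y$ (teachers are fair label classifiers). For each sample of $\bar D$ with features $X$, the ensemble outputs the noisy vote $$\tilde v(\bm T(X))=\operatorname*{argmax}_{c\in\mathcal C}\left\{\#_c(\bm T(X))+\tau_c\right\},\qquad \#_c(\bm T(X))=|\{k\in[K]:\mathcal M^{(k)}(X)=c\}|,$$ with $\tau_c\sim\mathcal N(0,\sigma^2)$ independent across $c\in\mathcal C$ and across the $s$ queries. The output of the algorithm is the student parameter $\hat\theta$, which is computed as a (measurable) function of $\bar D$ and the $s$ noisy votes only (it solves a regularized empirical risk minimization on $\bar D$: in SF$_S$-PATE with fairness constraints using the noisy votes as group attributes, in SF$_T$-PATE with the noisy votes as labels). *)

theory Defs
  imports "HOL-Probability.Probability"
begin

text \<open>
  Sequences indexed by \<open>[n]\<close> are extensional functions on \<open>{1..n}\<close>. The feature space is the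
  type \<open>'x\<close>, the group attributes are \<open>{1..m}\<close>, and the labels form a set \<open>Y\<close>.
\<close>

definition public_data :: "nat \<Rightarrow> 'y set \<Rightarrow> (nat \<Rightarrow> 'x \<times> 'y) set" where
  "public_data n Y = {1..n} \<rightarrow>\<^sub>E (UNIV \<times> Y)"

definition group_data :: "nat \<Rightarrow> nat \<Rightarrow> (nat \<Rightarrow> nat) set" where
  "group_data n m = {1..n} \<rightarrow>\<^sub>E {1..m}"

definition adjacent :: "nat \<Rightarrow> (nat \<Rightarrow> nat) \<Rightarrow> (nat \<Rightarrow> nat) \<Rightarrow> bool" where
  "adjacent n DS DS' \<longleftrightarrow> card {j \<in> {1..n}. DS j \<noteq> DS' j} \<le> 1"

text \<open>A mechanism sends a dataset to the distribution of its output on the measurable space \<open>N\<close>.\<close>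

definition dp_wrt_group ::
  "nat \<Rightarrow> nat \<Rightarrow> 'y set \<Rightarrow> 'p measure \<Rightarrow> real \<Rightarrow> real \<Rightarrow>
    ((nat \<Rightarrow> 'x \<times> 'y) \<Rightarrow> (nat \<Rightarrow> nat) \<Rightarrow> 'p measure) \<Rightarrow> bool" where
  "dp_wrt_group n m Y N \<epsilon> \<delta> M \<longleftrightarrow>
    (\<forall>DP \<in> public_data n Y. \<forall>DS \<in> group_data n m. \<forall>DS' \<in> group_data n m.
      adjacent n DS DS' \<longrightarrow>
      (\<forall>R \<in> sets N. measure (M DP DS) R \<le> exp \<epsilon> * measure (M DP DS') R + \<delta>))"

text \<open>
  A teacher is trained on a \<open>portion\<close>, which is undefined outside its index set \<open>J\<close>: the training
  rule cannot see any other sample.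
\<close>

definition portion ::
  "(nat \<Rightarrow> 'x \<times> 'y) \<Rightarrow> (nat \<Rightarrow> nat) \<Rightarrow> nat set \<Rightarrow> nat \<Rightarrow> 'x \<times> nat \<times> 'y" where
  "portion DP DS J = (\<lambda>j\<in>J. (fst (DP j), DS j, snd (DP j)))"

definition portions :: "nat \<Rightarrow> 'y set \<Rightarrow> nat set \<Rightarrow> (nat \<Rightarrow> 'x \<times> nat \<times> 'y) set" where
  "portions m Y J = J \<rightarrow>\<^sub>E (UNIV \<times> {1..m} \<times> Y)"

definition vote_count :: "nat \<Rightarrow> (nat \<Rightarrow> 'x \<Rightarrow> 'c) \<Rightarrow> 'x \<Rightarrow> 'c \<Rightarrow> nat" where
  "vote_count K T x c = card {k \<in> {1..K}. T k x = c}"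

text \<open>Ties, which have probability zero, are broken by the choice operator in \<^const>\<open>arg_max_on\<close>.\<close>

definition noisy_vote ::
  "nat \<Rightarrow> (nat \<Rightarrow> 'x \<Rightarrow> 'c) \<Rightarrow> 'c set \<Rightarrow> ('c \<Rightarrow> real) \<Rightarrow> 'x \<Rightarrow> 'c" where
  "noisy_vote K T C \<tau> x = arg_max_on (\<lambda>c. real (vote_count K T x c) + \<tau> c) C"

text \<open>
  The public samples given to the student are those with index in \<open>S\<close>; each of them is one query,
  with its own noise variable for every \<open>c \<in> C\<close>.
\<close>

definition vote_noise :: "real \<Rightarrow> nat set \<Rightarrow> 'c set \<Rightarrow> (nat \<times> 'c \<Rightarrow> real) measure" where
  "vote_noise \<sigma> S C = (\<Pi>\<^sub>M _ \<in> S \<times> C. density lborel (normal_density 0 \<sigma>))"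

definition ensemble_votes ::
  "nat \<Rightarrow> (nat \<Rightarrow> 'x \<Rightarrow> 'c) \<Rightarrow> 'c set \<Rightarrow> nat set \<Rightarrow> (nat \<Rightarrow> 'x \<times> 'y) \<Rightarrow>
    (nat \<times> 'c \<Rightarrow> real) \<Rightarrow> nat \<Rightarrow> 'c" where
  "ensemble_votes K T C S DP \<tau> = (\<lambda>j\<in>S. noisy_vote K T C (\<lambda>c. \<tau> (j, c)) (fst (DP j)))"

definition sf_pate ::
  "'c set \<Rightarrow> nat \<Rightarrow> (nat \<Rightarrow> nat set) \<Rightarrow> (nat \<Rightarrow> (nat \<Rightarrow> 'x \<times> nat \<times> 'y) \<Rightarrow> 'x \<Rightarrow> 'c) \<Rightarrow>
    real \<Rightarrow> nat set \<Rightarrow> 'p measure \<Rightarrow> ((nat \<Rightarrow> 'x \<times> 'y) \<Rightarrow> (nat \<Rightarrow> 'c) \<Rightarrow> 'p) \<Rightarrow>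
    (nat \<Rightarrow> 'x \<times> 'y) \<Rightarrow> (nat \<Rightarrow> nat) \<Rightarrow> 'p measure" where
  "sf_pate C K I train \<sigma> S N student DP DS =
    distr (vote_noise \<sigma> S C) N
      (\<lambda>\<tau>. student (restrict DP S)
        (ensemble_votes K (\<lambda>k. train k (portion DP DS (I k))) C S DP \<tau>))"

definition sf_S_pate ::
  "nat \<Rightarrow> nat \<Rightarrow> (nat \<Rightarrow> nat set) \<Rightarrow> (nat \<Rightarrow> (nat \<Rightarrow> 'x \<times> nat \<times> 'y) \<Rightarrow> 'x \<Rightarrow> nat) \<Rightarrow>
    real \<Rightarrow> nat set \<Rightarrow> 'p measure \<Rightarrow> ((nat \<Rightarrow> 'x \<times> 'y) \<Rightarrow> (nat \<Rightarrow> nat) \<Rightarrow> 'p) \<Rightarrow>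
    (nat \<Rightarrow> 'x \<times> 'y) \<Rightarrow> (nat \<Rightarrow> nat) \<Rightarrow> 'p measure" where
  "sf_S_pate m = sf_pate {1..m}"

definition sf_T_pate ::
  "'y set \<Rightarrow> nat \<Rightarrow> (nat \<Rightarrow> nat set) \<Rightarrow> (nat \<Rightarrow> (nat \<Rightarrow> 'x \<times> nat \<times> 'y) \<Rightarrow> 'x \<Rightarrow> 'y) \<Rightarrow>
    real \<Rightarrow> nat set \<Rightarrow> 'p measure \<Rightarrow> ((nat \<Rightarrow> 'x \<times> 'y) \<Rightarrow> (nat \<Rightarrow> 'y) \<Rightarrow> 'p) \<Rightarrow>
    (nat \<Rightarrow> 'x \<times> 'y) \<Rightarrow> (nat \<Rightarrow> nat) \<Rightarrow> 'p measure" where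
  "sf_T_pate Y = sf_pate Y"

text \<open>
  Training rules produce classifiers into \<open>C\<close>. The student map is measurable in the votes for each
  fixed set of public samples (all that matters, as the public part is never random).
\<close>

definition teachers_into ::
  "'c set \<Rightarrow> nat \<Rightarrow> 'y set \<Rightarrow> nat \<Rightarrow> (nat \<Rightarrow> nat set) \<Rightarrow>
    (nat \<Rightarrow> (nat \<Rightarrow> 'x \<times> nat \<times> 'y) \<Rightarrow> 'x \<Rightarrow> 'c) \<Rightarrow> bool" where
  "teachers_into C m Y K I train \<longleftrightarrow>
    (\<forall>k \<in> {1..K}. \<forall>D \<in> portions m Y (I k). \<forall>x. train k D x \<in> C)"

definition measurable_student ::
  "'c set \<Rightarrow> 'y set \<Rightarrow> nat set \<Rightarrow> 'p measure \<Rightarrow>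
    ((nat \<Rightarrow> 'x \<times> 'y) \<Rightarrow> (nat \<Rightarrow> 'c) \<Rightarrow> 'p) \<Rightarrow> bool" where
  "measurable_student C Y S N student \<longleftrightarrow>
    (\<forall>Db \<in> S \<rightarrow>\<^sub>E (UNIV \<times> Y). student Db \<in> (\<Pi>\<^sub>M _ \<in> S. count_space C) \<rightarrow>\<^sub>M N)"

text \<open>
  \<^const>\<open>distr\<close> is a junk value on non-measurable maps, so we check that the output of the algorithm
  really is a probability distribution.
\<close>

lemma measurable_arg_max_on:
  fixes h :: "'c \<Rightarrow> 'w \<Rightarrow> real"
  assumes C: "finite C" "C \<noteq> {}" and h: "\<And>c. c \<in> C \<Longrightarrow> h c \<in> borel_measurable W"
  shows "(\<lambda>w. arg_max_on (\<lambda>c. h c w) C) \<in> W \<rightarrow>\<^sub>M count_space C"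
proof -
  define g where "g w = {c \<in> C. \<forall>y\<in>C. h y w \<le> h c w}" for w
  have pick: "arg_max_on (\<lambda>c. h c w) C = (SOME c. c \<in> g w)" for w
    by (simp add: arg_max_on_def arg_max_def is_arg_max_def g_def not_less Ball_def)
  have ne: "g w \<noteq> {}" for w
  proof -
    obtain c where "c \<in> C" "\<forall>y\<in>C. h y w \<le> h c w"
      using C Max_in[of "(\<lambda>c. h c w) ` C"] Max_ge[of "(\<lambda>c. h c w) ` C"] by fastforce
    then show ?thesis by (auto simp: g_def)
  qed
  have sel: "{w \<in> space W. (c \<in> B) = (\<forall>y\<in>C. h y w \<le> h c w)} \<in> sets W"
    if "c \<in> C" for c B
  proof -
    have "{w \<in> space W. h y w \<le> h c w} \<in> sets W" if "y \<in> C" for y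
      using h[OF \<open>c \<in> C\<close>] h[OF that] by measurable
    then have "{w \<in> space W. \<forall>y\<in>C. h y w \<le> h c w} \<in> sets W"
      by (rule sets.sets_Collect_finite_All[where P = "\<lambda>y w. h y w \<le> h c w", OF _ C(1)])
    then show ?thesis
      by (cases "c \<in> B") (simp_all only: simp_thms sets.sets_Collect_neg)
  qed
  have g: "g \<in> W \<rightarrow>\<^sub>M count_space (Pow C)"
  proof (subst measurable_count_space_eq2, use C in simp, intro conjI ballI)
    show "g \<in> space W \<rightarrow> Pow C" by (auto simp: g_def)
    fix B assume "B \<in> Pow C"
    then have "g w = B \<longleftrightarrow> (\<forall>c\<in>C. (c \<in> B) = (\<forall>y\<in>C. h y w \<le> h c w))" for w
      unfolding g_def by blast
    then have "g -` {B} \<inter> space W =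
        {w \<in> space W. \<forall>c\<in>C. (c \<in> B) = (\<forall>y\<in>C. h y w \<le> h c w)}"
      by blast
    also have "\<dots> \<in> sets W"
      by (rule sets.sets_Collect_finite_All
          [where P = "\<lambda>c w. (c \<in> B) = (\<forall>y\<in>C. h y w \<le> h c w)", OF sel C(1)])
    finally show "g -` {B} \<inter> space W \<in> sets W" .
  qed
  have "(SOME c. c \<in> (if B = {} then C else B)) \<in> C" if "B \<in> Pow C" for B
    using that some_in_eq[of "if B = {} then C else B"] C(2) by (cases "B = {}") auto
  then have "(\<lambda>B. SOME c. c \<in> (if B = {} then C else B))
      \<in> count_space (Pow C) \<rightarrow>\<^sub>M count_space C"
    by (simp only: measurable_count_space_eq1 space_count_space) (rule Pi_I)
  from measurable_compose[OF g this] show ?thesis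
    by (simp only: pick ne if_False)
qed

lemma measurable_ensemble_votes:
  assumes C: "finite C" "C \<noteq> {}"
  shows "ensemble_votes K T C S DP \<in> vote_noise \<sigma> S C \<rightarrow>\<^sub>M (\<Pi>\<^sub>M _ \<in> S. count_space C)"
  unfolding ensemble_votes_def noisy_vote_def
proof (rule measurable_restrict, rule measurable_arg_max_on[OF C])
  fix j c assume "j \<in> S" "c \<in> C"
  then have "(\<lambda>\<tau>. \<tau> (j, c)) \<in> vote_noise \<sigma> S C \<rightarrow>\<^sub>M density lborel (normal_density 0 \<sigma>)"
    unfolding vote_noise_def by (intro measurable_component_singleton) auto
  then show "(\<lambda>\<tau>. real (vote_count K T (fst (DP j)) c) + \<tau> (j, c))
      \<in> borel_measurable (vote_noise \<sigma> S C)"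
    by (intro borel_measurable_add) (auto cong: measurable_cong_sets)
qed

lemma prob_space_sf_pate:
  assumes "0 < \<sigma>" "finite C" "C \<noteq> {}" "S \<subseteq> {1..n}" "DP \<in> public_data n Y"
    and "measurable_student C Y S N student"
  shows "prob_space (sf_pate C K I train \<sigma> S N student DP DS)"
proof -
  interpret prob_space "vote_noise \<sigma> S C"
    unfolding vote_noise_def using assms(1) by (intro prob_space_PiM prob_space_normal_density)
  have "restrict DP S \<in> S \<rightarrow>\<^sub>E (UNIV \<times> Y)"
    using assms(4,5) by (auto simp: public_data_def PiE_def Pi_def)
  then show ?thesis
    unfolding sf_pate_def using assms(2,3,6) unfolding measurable_student_def
    by (intro prob_space_distr measurable_compose[OF measurable_ensemble_votes]) blast+
qed

end

(*
  Changing one group attribute alters the training data of a single teacher, so in each query at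
  most two vote counts change, each by at most one: the vector of all counts moves by at most
  sqrt (2 s) in Euclidean norm. The output is a function of these counts plus Gaussian noise, whose
  Renyi divergence of order \<gamma> is therefore at most \<gamma> (2 s) / (2 \<sigma>^2) = s \<gamma> / \<sigma>^2. A Renyi bound \<rho>
  yields approximate privacy by Markov's inequality for the (\<gamma> - 1)-st power of the density ratio.
*)

theory Submission
  imports Defs
begin

section \<open>Densities and images of finite product measures\<close>

text \<open>Measurable boxes determine a finite product of sigma-finite measures, and on a box
  Tonelli factors the integral into one-dimensional ones. This combines coordinatewise changes of
  measure into a single one.\<close>

lemma PiM_density:
  assumes I: "finite I"
    and M: "\<And>i. sigma_finite_measure (M i)"
    and D: "\<And>i. sigma_finite_measure (density (M i) (f i))"
    and f [measurable]: "\<And>i. f i \<in> borel_measurable (M i)"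
  shows "density (PiM I M) (\<lambda>x. \<Prod>i\<in>I. f i (x i)) = PiM I (\<lambda>i. density (M i) (f i))"
proof -
  interpret M: product_sigma_finite M by (rule product_sigma_finite.intro) (rule M)
  interpret D: product_sigma_finite "\<lambda>i. density (M i) (f i)" by (rule product_sigma_finite.intro) (rule D)
  show ?thesis
  proof (rule D.PiM_eqI[OF I])
    show "sets (density (PiM I M) (\<lambda>x. \<Prod>i\<in>I. f i (x i))) =
        sets (PiM I (\<lambda>i. density (M i) (f i)))"
      by (simp cong: sets_PiM_cong)
  next
    fix A assume "\<And>i. i \<in> I \<Longrightarrow> A i \<in> sets (density (M i) (f i))"
    then have A: "\<And>i. i \<in> I \<Longrightarrow> A i \<in> sets (M i)" by simp
    have prodm: "(\<lambda>x. \<Prod>i\<in>I. f i (x i)) \<in> borel_measurable (PiM I M)"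
      by measurable
    have "emeasure (density (PiM I M) (\<lambda>x. \<Prod>i\<in>I. f i (x i))) (Pi\<^sub>E I A)
        = (\<integral>\<^sup>+x. (\<Prod>i\<in>I. f i (x i)) * indicator (Pi\<^sub>E I A) x \<partial>PiM I M)"
      using A I by (intro emeasure_density prodm sets_PiM_I_finite) auto
    also have "\<dots> = (\<integral>\<^sup>+x. (\<Prod>i\<in>I. f i (x i) * indicator (A i) (x i)) \<partial>PiM I M)"
    proof (rule nn_integral_cong)
      fix x assume "x \<in> space (PiM I M)"
      \<comment> \<open>Membership in \<open>Pi\<^sub>E I A\<close> includes extensionality, so the
        box indicator factors only on the space of the product.\<close>
      then have "x \<in> extensional I" by (simp add: space_PiM PiE_def)
      then have "indicator (Pi\<^sub>E I A) x = (\<Prod>i\<in>I. indicator (A i) (x i) :: ennreal)"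
        using I by (auto simp: indicator_def PiE_def Pi_def)
      then show "(\<Prod>i\<in>I. f i (x i)) * indicator (Pi\<^sub>E I A) x =
          (\<Prod>i\<in>I. f i (x i) * indicator (A i) (x i))"
        by (simp add: prod.distrib)
    qed
    also have "\<dots> = (\<Prod>i\<in>I. \<integral>\<^sup>+x. f i x * indicator (A i) x \<partial>M i)"
      using A I by (intro M.product_nn_integral_prod) auto
    also have "\<dots> = (\<Prod>i\<in>I. emeasure (density (M i) (f i)) (A i))"
      using A by (intro prod.cong refl emeasure_density[symmetric]) auto
    finally show "emeasure (density (PiM I M) (\<lambda>x. \<Prod>i\<in>I. f i (x i))) (Pi\<^sub>E I A)
        = (\<Prod>i\<in>I. emeasure (density (M i) (f i)) (A i))" .
  qed
qed

text \<open>The preimage of a box under a coordinatewise map is again a box, so both sides agree on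
  boxes. Used with translations, to move the means of the noise.\<close>

lemma PiM_distr:
  assumes I: "finite I"
    and M: "\<And>i. prob_space (M i)"
    and f [measurable]: "\<And>i. f i \<in> M i \<rightarrow>\<^sub>M N i"
  shows "distr (PiM I M) (PiM I N) (\<lambda>x. \<lambda>i\<in>I. f i (x i)) = PiM I (\<lambda>i. distr (M i) (N i) (f i))"
proof -
  interpret M: product_sigma_finite M
    by (intro product_sigma_finite.intro prob_space_imp_sigma_finite M)
  interpret D: product_sigma_finite "\<lambda>i. distr (M i) (N i) (f i)"
    by (intro product_sigma_finite.intro prob_space_imp_sigma_finite prob_space.prob_space_distr M f)
  show ?thesis
  proof (rule D.PiM_eqI[OF I])
    show "sets (distr (PiM I M) (PiM I N) (\<lambda>x. \<lambda>i\<in>I. f i (x i))) =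
        sets (PiM I (\<lambda>i. distr (M i) (N i) (f i)))"
      by (simp cong: sets_PiM_cong)
  next
    fix A assume "\<And>i. i \<in> I \<Longrightarrow> A i \<in> sets (distr (M i) (N i) (f i))"
    then have A: "\<And>i. i \<in> I \<Longrightarrow> A i \<in> sets (N i)" by simp
    have "emeasure (distr (PiM I M) (PiM I N) (\<lambda>x. \<lambda>i\<in>I. f i (x i))) (Pi\<^sub>E I A)
        = emeasure (PiM I M) ((\<lambda>x. \<lambda>i\<in>I. f i (x i)) -` Pi\<^sub>E I A \<inter> space (PiM I M))"
      using A I by (intro emeasure_distr sets_PiM_I_finite) auto
    also have "(\<lambda>x. \<lambda>i\<in>I. f i (x i)) -` Pi\<^sub>E I A \<inter> space (PiM I M)
        = Pi\<^sub>E I (\<lambda>i. f i -` A i \<inter> space (M i))"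
      by (auto simp: space_PiM PiE_def Pi_def restrict_def extensional_def)
    also have "emeasure (PiM I M) \<dots> = (\<Prod>i\<in>I. emeasure (M i) (f i -` A i \<inter> space (M i)))"
      using A I by (intro M.emeasure_PiM measurable_sets[OF f]) auto
    also have "\<dots> = (\<Prod>i\<in>I. emeasure (distr (M i) (N i) (f i)) (A i))"
      using A by (intro prod.cong refl emeasure_distr[symmetric]) auto
    finally show "emeasure (distr (PiM I M) (PiM I N) (\<lambda>x. \<lambda>i\<in>I. f i (x i))) (Pi\<^sub>E I A)
        = (\<Prod>i\<in>I. emeasure (distr (M i) (N i) (f i)) (A i))" .
  qed
qed

section \<open>From Renyi divergence to approximate privacy\<close>

text \<open>When \<open>density Q r\<close> is a probability measure, \<open>renyi\<close> says that
  its Renyi divergence of order \<gamma> from \<open>Q\<close> is at most \<rho>. Where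
  \<open>r\<close> is at most the exponential of the privacy parameter, the multiplicative term pays
  for \<open>R\<close>; the rest is charged to \<delta>.\<close>

lemma renyi_bound_imp_approx_dp:
  fixes r :: "'a \<Rightarrow> real" and \<gamma> \<delta> \<rho> :: real
  assumes r [measurable]: "r \<in> borel_measurable Q" and pos: "\<And>x. 0 < r x"
    and "1 < \<gamma>" "0 < \<delta>"
    and renyi: "(\<integral>\<^sup>+x. ennreal (r x powr \<gamma>) \<partial>Q) \<le> ennreal (exp ((\<gamma> - 1) * \<rho>))"
    and R [measurable]: "R \<in> sets Q"
  shows "emeasure (density Q r) R \<le>
    ennreal (exp (\<rho> + ln (1 / \<delta>) / (\<gamma> - 1))) * emeasure Q R + ennreal \<delta>"
proof -
  define \<epsilon> where "\<epsilon> = \<rho> + ln (1 / \<delta>) / (\<gamma> - 1)"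
  \<comment> \<open>This equation dictates the choice of \<epsilon>: the Markov factor times the
    moment bound must come out as \<delta>.\<close>
  have \<delta>: "exp (- (\<gamma> - 1) * \<epsilon>) * exp ((\<gamma> - 1) * \<rho>) = \<delta>"
  proof -
    have "(\<gamma> - 1) * \<epsilon> = (\<gamma> - 1) * \<rho> - ln \<delta>"
      using assms(3,4) by (simp add: \<epsilon>_def ln_div field_simps)
    then have "- (\<gamma> - 1) * \<epsilon> + (\<gamma> - 1) * \<rho> = ln \<delta>"
      by (simp only: mult_minus_left)
    then show ?thesis
      using assms(4) by (metis exp_add exp_ln)
  qed
  \<comment> \<open>Markov's inequality for \<open>r powr (\<gamma> - 1)\<close> at the threshold \<open>exp \<epsilon>\<close>, before integration.\<close>
  have ptw: "r x \<le> exp \<epsilon> \<or> r x \<le> exp (- (\<gamma> - 1) * \<epsilon>) * r x powr \<gamma>" for x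
  proof (cases "r x \<le> exp \<epsilon>")
    case False
    then have "\<epsilon> \<le> ln (r x)"
      using pos[of x] by (simp add: ln_ge_iff)
    then have "0 \<le> (\<gamma> - 1) * (ln (r x) - \<epsilon>)"
      using assms(3) by simp
    then have "ln (r x) \<le> - (\<gamma> - 1) * \<epsilon> + \<gamma> * ln (r x)"
      by (simp add: algebra_simps)
    then have "exp (ln (r x)) \<le> exp (- (\<gamma> - 1) * \<epsilon> + \<gamma> * ln (r x))"
      by simp
    then show ?thesis
      unfolding exp_add using pos[of x] by (simp add: powr_def)
  qed simp
  have "emeasure (density Q r) R = (\<integral>\<^sup>+x. ennreal (r x) * indicator R x \<partial>Q)"
    by (simp add: emeasure_density)
  \<comment> \<open>The sum of the two bounds in \<open>ptw\<close> dominates either one. The moment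
    term loses its indicator so that \<open>renyi\<close> applies to it.\<close>
  also have "\<dots> \<le> (\<integral>\<^sup>+x. ennreal (exp \<epsilon>) * indicator R x
      + ennreal (exp (- (\<gamma> - 1) * \<epsilon>)) * ennreal (r x powr \<gamma>) \<partial>Q)"
  proof (rule nn_integral_mono)
    fix x
    show "ennreal (r x) * indicator R x \<le> ennreal (exp \<epsilon>) * indicator R x
      + ennreal (exp (- (\<gamma> - 1) * \<epsilon>)) * ennreal (r x powr \<gamma>)"
    proof (cases "x \<in> R")
      case True
      have "r x \<le> exp \<epsilon> + exp (- (\<gamma> - 1) * \<epsilon>) * r x powr \<gamma>"
        using ptw[of x] by (smt (verit) exp_ge_zero powr_ge_zero mult_nonneg_nonneg)
      then show ?thesis
        using True by (simp add: ennreal_mult[symmetric] ennreal_plus[symmetric] del: ennreal_plus)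
    qed simp
  qed
  also have "\<dots> = ennreal (exp \<epsilon>) * emeasure Q R
      + ennreal (exp (- (\<gamma> - 1) * \<epsilon>)) * (\<integral>\<^sup>+x. ennreal (r x powr \<gamma>) \<partial>Q)"
    by (subst nn_integral_add) (auto simp: nn_integral_cmult)
  also have "\<dots> \<le> ennreal (exp \<epsilon>) * emeasure Q R
      + ennreal (exp (- (\<gamma> - 1) * \<epsilon>)) * ennreal (exp ((\<gamma> - 1) * \<rho>))"
    by (intro add_left_mono mult_left_mono renyi) simp
  also have "\<dots> = ennreal (exp \<epsilon>) * emeasure Q R + ennreal \<delta>"
    by (subst ennreal_mult[symmetric]) (simp_all add: \<delta>[simplified])
  finally show ?thesis by (simp add: \<epsilon>_def)
qed

section \<open>Likelihood ratios of Gaussians with equal variance\<close>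

definition gaussian :: "real \<Rightarrow> real \<Rightarrow> real measure" where
  "gaussian \<sigma> a = density lborel (normal_density a \<sigma>)"

text \<open>The Radon-Nikodym derivative of the Gaussian with mean \<open>a\<close> with respect to
  the one with mean \<open>b\<close>. As a single exponential, it is visibly positive and its powers
  are easy to compute.\<close>

definition gaussian_ratio :: "real \<Rightarrow> real \<Rightarrow> real \<Rightarrow> real \<Rightarrow> real" where
  "gaussian_ratio \<sigma> a b x = exp ((a - b) * (2 * x - a - b) / (2 * \<sigma>\<^sup>2))"

lemma sets_gaussian [simp, measurable_cong]: "sets (gaussian \<sigma> a) = sets borel"
  by (simp add: gaussian_def)

lemma space_gaussian [simp]: "space (gaussian \<sigma> a) = UNIV"
  by (simp add: gaussian_def)

lemma prob_space_gaussian: "0 < \<sigma> \<Longrightarrow> prob_space (gaussian \<sigma> a)"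
  unfolding gaussian_def by (rule prob_space_normal_density)

lemma gaussian_ratio_pos [simp]: "0 < gaussian_ratio \<sigma> a b x"
  by (simp add: gaussian_ratio_def)

lemma gaussian_ratio_measurable [measurable]: "gaussian_ratio \<sigma> a b \<in> borel_measurable borel"
  unfolding gaussian_ratio_def [abs_def] by measurable

lemma normal_density_ratio:
  assumes "0 < \<sigma>"
  shows "normal_density b \<sigma> x * gaussian_ratio \<sigma> a b x = normal_density a \<sigma> x"
proof -
  have "- (x - b)\<^sup>2 + (a - b) * (2 * x - a - b) = - (x - a)\<^sup>2"
    by (simp add: power2_eq_square algebra_simps)
  then have "- (x - b)\<^sup>2 / (2 * \<sigma>\<^sup>2) + (a - b) * (2 * x - a - b) / (2 * \<sigma>\<^sup>2) = - (x - a)\<^sup>2 / (2 * \<sigma>\<^sup>2)"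
    by (metis add_divide_distrib)
  then show ?thesis
    by (simp add: normal_density_def gaussian_ratio_def exp_add[symmetric])
qed

lemma density_gaussian_ratio:
  assumes "0 < \<sigma>"
  shows "density (gaussian \<sigma> b) (gaussian_ratio \<sigma> a b) = gaussian \<sigma> a"
  using normal_density_ratio[OF assms]
  by (simp add: gaussian_def density_density_eq ennreal_mult[symmetric] less_imp_le)

text \<open>For \<open>\<gamma> > 1\<close> this is the Renyi divergence
  \<open>\<gamma> * (a - b)\<^sup>2 / (2 * \<sigma>\<^sup>2)\<close> of two Gaussians, multiplied by
  \<open>\<gamma> - 1\<close> and exponentiated.\<close>

lemma nn_integral_gaussian_ratio_powr:
  assumes "0 < \<sigma>"
  shows "(\<integral>\<^sup>+x. ennreal (gaussian_ratio \<sigma> a b x powr \<gamma>) \<partial>gaussian \<sigma> b) =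
    ennreal (exp (\<gamma> * (\<gamma> - 1) * (a - b)\<^sup>2 / (2 * \<sigma>\<^sup>2)))"
proof -
  \<comment> \<open>The integrand has exponent \<open>- (\<gamma> * (x - a)\<^sup>2 + (1 - \<gamma>)
    * (x - b)\<^sup>2) / (2 * \<sigma>\<^sup>2)\<close>; \<open>?\<mu>\<close> is its vertex, and
    \<open>?c\<close> the exponential of its value there.\<close>
  let ?c = "exp (\<gamma> * (\<gamma> - 1) * (a - b)\<^sup>2 / (2 * \<sigma>\<^sup>2))" and ?\<mu> = "\<gamma> * a + (1 - \<gamma>) * b"
  \<comment> \<open>Completing the square turns the integrand into a multiple of another normal density.\<close>
  have *: "normal_density b \<sigma> x * gaussian_ratio \<sigma> a b x powr \<gamma> = ?c * normal_density ?\<mu> \<sigma> x" for x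
  proof -
    have "- (x - b)\<^sup>2 + \<gamma> * ((a - b) * (2 * x - a - b)) = \<gamma> * (\<gamma> - 1) * (a - b)\<^sup>2 + - (x - ?\<mu>)\<^sup>2"
      by (simp add: power2_eq_square algebra_simps)
    then have "- (x - b)\<^sup>2 / (2 * \<sigma>\<^sup>2) + \<gamma> * ((a - b) * (2 * x - a - b) / (2 * \<sigma>\<^sup>2)) =
        \<gamma> * (\<gamma> - 1) * (a - b)\<^sup>2 / (2 * \<sigma>\<^sup>2) + - (x - ?\<mu>)\<^sup>2 / (2 * \<sigma>\<^sup>2)"
      by (metis add_divide_distrib times_divide_eq_right)
    then show ?thesis
      by (simp add: normal_density_def gaussian_ratio_def exp_powr_real exp_add[symmetric] mult.commute)
  qed
  have "(\<integral>\<^sup>+x. ennreal (gaussian_ratio \<sigma> a b x powr \<gamma>) \<partial>gaussian \<sigma> b) =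
      (\<integral>\<^sup>+x. ennreal (normal_density b \<sigma> x * gaussian_ratio \<sigma> a b x powr \<gamma>) \<partial>lborel)"
    by (simp add: gaussian_def nn_integral_density ennreal_mult)
  also have "\<dots> = ennreal ?c * (\<integral>\<^sup>+x. ennreal (normal_density ?\<mu> \<sigma> x) \<partial>lborel)"
    unfolding * by (subst nn_integral_cmult[symmetric]) (auto simp: ennreal_mult)
  also have "(\<integral>\<^sup>+x. ennreal (normal_density ?\<mu> \<sigma> x) \<partial>lborel) = 1"
    using assms by (simp add: nn_integral_eq_integral)
  finally show ?thesis by simp
qed

lemma distr_gaussian_add:
  assumes "0 < \<sigma>"
  shows "distr (gaussian \<sigma> 0) borel (\<lambda>x. a + x) = gaussian \<sigma> a"
proof -
  interpret prob_space "gaussian \<sigma> 0" by (rule prob_space_gaussian[OF assms])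
  have "distributed (gaussian \<sigma> 0) lborel (\<lambda>x. x) (normal_density 0 \<sigma>)"
    by (auto simp: distributed_def gaussian_def intro!: distr_id2)
  from normal_density_affine[OF this assms, of 1 a] show ?thesis
    by (simp add: distributed_def gaussian_def cong: distr_cong)
qed

text \<open>Independence makes the divergences of the coordinates add up, so only the squared
  Euclidean distance of the mean vectors matters. The factor 2 in \<open>sens\<close> cancels the
  one in \<open>2 * \<sigma>\<^sup>2\<close>.\<close>

lemma gaussian_mechanism_approx_dp:
  fixes a b :: "'i \<Rightarrow> real"
  assumes J: "finite J" and "0 < \<sigma>" "1 < \<gamma>" "0 < \<delta>"
    and sens: "(\<Sum>i\<in>J. (a i - b i)\<^sup>2) \<le> 2 * s"
    and R: "R \<in> sets (\<Pi>\<^sub>M i\<in>J. borel)"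
  shows "measure (\<Pi>\<^sub>M i\<in>J. gaussian \<sigma> (a i)) R \<le>
    exp (s * \<gamma> / \<sigma>\<^sup>2 + ln (1 / \<delta>) / (\<gamma> - 1)) * measure (\<Pi>\<^sub>M i\<in>J. gaussian \<sigma> (b i)) R + \<delta>"
proof -
  let ?P = "\<Pi>\<^sub>M i\<in>J. gaussian \<sigma> (a i)" and ?Q = "\<Pi>\<^sub>M i\<in>J. gaussian \<sigma> (b i)"
  let ?\<epsilon> = "s * \<gamma> / \<sigma>\<^sup>2 + ln (1 / \<delta>) / (\<gamma> - 1)"
  define r where "r x = (\<Prod>i\<in>J. gaussian_ratio \<sigma> (a i) (b i) (x i))" for x
  have sf: "sigma_finite_measure (gaussian \<sigma> c)" for c
    by (intro prob_space_imp_sigma_finite prob_space_gaussian assms)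
  interpret P: prob_space ?P by (intro prob_space_PiM prob_space_gaussian assms)
  interpret Q: prob_space ?Q by (intro prob_space_PiM prob_space_gaussian assms)
  interpret G: product_sigma_finite "\<lambda>i. gaussian \<sigma> (b i)" by (rule product_sigma_finite.intro) (rule sf)
  have [measurable]: "r \<in> borel_measurable ?Q"
    unfolding r_def by measurable
  have r_pos: "0 < r x" for x
    unfolding r_def by (intro prod_pos) simp
  have "?P = (\<Pi>\<^sub>M i\<in>J. density (gaussian \<sigma> (b i)) (gaussian_ratio \<sigma> (a i) (b i)))"
    by (simp add: density_gaussian_ratio assms)
  also have "\<dots> = density ?Q (\<lambda>x. \<Prod>i\<in>J. ennreal (gaussian_ratio \<sigma> (a i) (b i) (x i)))"
    by (rule PiM_density[symmetric]) (simp_all add: J sf density_gaussian_ratio assms)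
  also have "\<dots> = density ?Q r"
    by (simp add: r_def prod_ennreal less_imp_le)
  finally have P: "?P = density ?Q r" .
  have "(\<integral>\<^sup>+x. ennreal (r x powr \<gamma>) \<partial>?Q)
      = (\<integral>\<^sup>+x. (\<Prod>i\<in>J. ennreal (gaussian_ratio \<sigma> (a i) (b i) (x i) powr \<gamma>)) \<partial>?Q)"
    by (simp add: r_def prod_ennreal prod_powr_distrib less_imp_le)
  also have "\<dots> = (\<Prod>i\<in>J. \<integral>\<^sup>+x. ennreal (gaussian_ratio \<sigma> (a i) (b i) x powr \<gamma>) \<partial>gaussian \<sigma> (b i))"
    by (rule G.product_nn_integral_prod[OF J]) simp
  also have "\<dots> = ennreal (exp (\<Sum>i\<in>J. \<gamma> * (\<gamma> - 1) * (a i - b i)\<^sup>2 / (2 * \<sigma>\<^sup>2)))"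
    by (simp add: nn_integral_gaussian_ratio_powr assms prod_ennreal exp_sum)
  also have "\<dots> \<le> ennreal (exp ((\<gamma> - 1) * (s * \<gamma> / \<sigma>\<^sup>2)))"
  proof -
    have "(\<Sum>i\<in>J. \<gamma> * (\<gamma> - 1) * (a i - b i)\<^sup>2 / (2 * \<sigma>\<^sup>2))
        = \<gamma> * (\<gamma> - 1) / (2 * \<sigma>\<^sup>2) * (\<Sum>i\<in>J. (a i - b i)\<^sup>2)"
      by (simp add: sum_distrib_left)
    also have "\<dots> \<le> \<gamma> * (\<gamma> - 1) / (2 * \<sigma>\<^sup>2) * (2 * s)"
      using assms(2,3) by (intro mult_left_mono sens) auto
    also have "\<dots> = (\<gamma> - 1) * (s * \<gamma> / \<sigma>\<^sup>2)"
      by simp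
    finally show ?thesis by (simp add: ennreal_leI)
  qed
  finally have renyi: "(\<integral>\<^sup>+x. ennreal (r x powr \<gamma>) \<partial>?Q) \<le> ennreal (exp ((\<gamma> - 1) * (s * \<gamma> / \<sigma>\<^sup>2)))" .
  have "R \<in> sets ?Q"
    using R by (simp cong: sets_PiM_cong)
  with renyi_bound_imp_approx_dp[OF _ r_pos assms(3,4) renyi]
  have "emeasure ?P R \<le> ennreal (exp ?\<epsilon>) * emeasure ?Q R + ennreal \<delta>"
    by (simp add: P)
  also have "\<dots> = ennreal (exp ?\<epsilon> * measure ?Q R + \<delta>)"
    using assms(4) by (simp add: Q.emeasure_eq_measure ennreal_mult)
  finally show ?thesis
    using assms(4) by (simp add: P.emeasure_eq_measure del: ennreal_plus)
qed

section \<open>The algorithms as post-processing of noisy counts\<close>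

text \<open>The two maximality predicates coincide as functions, so the choice operator picks the
  same maximiser even in a tie. This allows scores to be undefined off \<open>C\<close>.\<close>

lemma arg_max_on_cong:
  assumes "\<And>c. c \<in> C \<Longrightarrow> f c = g c"
  shows "arg_max_on f C = arg_max_on g C"
proof -
  have "is_arg_max f (\<lambda>x. x \<in> C) = is_arg_max g (\<lambda>x. x \<in> C)"
    using assms by (auto simp: is_arg_max_def fun_eq_iff)
  then show ?thesis
    by (simp add: arg_max_on_def arg_max_def)
qed

text \<open>Isolates the part of the voting that sees neither the data nor the teachers, only the
  noisy counts.\<close>

definition votes_of_scores :: "'c set \<Rightarrow> nat set \<Rightarrow> (nat \<times> 'c \<Rightarrow> real) \<Rightarrow> nat \<Rightarrow> 'c" where
  "votes_of_scores C S u = (\<lambda>j\<in>S. arg_max_on (\<lambda>c. u (j, c)) C)"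

lemma measurable_votes_of_scores:
  assumes "finite C" "C \<noteq> {}"
  shows "votes_of_scores C S \<in> (\<Pi>\<^sub>M i\<in>S \<times> C. borel) \<rightarrow>\<^sub>M (\<Pi>\<^sub>M _\<in>S. count_space C)"
  unfolding votes_of_scores_def
  by (rule measurable_restrict, rule measurable_arg_max_on[OF assms]) simp

text \<open>Adding a count to centred noise gives a Gaussian centred at the count. The group
  attributes enter only through these means, since \<open>h\<close> does not mention
  \<open>DS\<close>; privacy of the scores therefore passes to the output.\<close>

lemma sf_pate_eq_distr_gaussian:
  fixes C :: "'c set" and Y :: "'y set" and I :: "nat \<Rightarrow> nat set" and DS :: "nat \<Rightarrow> nat"
    and train :: "nat \<Rightarrow> (nat \<Rightarrow> 'x \<times> nat \<times> 'y) \<Rightarrow> 'x \<Rightarrow> 'c"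
  assumes "0 < \<sigma>" "finite C" "C \<noteq> {}" "finite S" "S \<subseteq> {1..n}" "DP \<in> public_data n Y"
    and st: "measurable_student C Y S N student"
  defines "h \<equiv> \<lambda>u. student (restrict DP S) (votes_of_scores C S u)"
    and "T \<equiv> \<lambda>k. train k (portion DP DS (I k))"
  shows "h \<in> (\<Pi>\<^sub>M i\<in>S \<times> C. borel) \<rightarrow>\<^sub>M N"
    and "sf_pate C K I train \<sigma> S N student DP DS =
      distr (\<Pi>\<^sub>M i\<in>S \<times> C. gaussian \<sigma> (real (vote_count K T (fst (DP (fst i))) (snd i)))) N h"
proof -
  define v where "v i = real (vote_count K T (fst (DP (fst i))) (snd i))" for i
  \<comment> \<open>The restriction keeps the shifted noise extensional, hence in the product
    space.\<close>
  define shift where "shift \<tau> = (\<lambda>i\<in>S \<times> C. v i + \<tau> i)" for \<tau> :: "nat \<times> 'c \<Rightarrow> real"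
  have "restrict DP S \<in> S \<rightarrow>\<^sub>E (UNIV \<times> Y)"
    using assms(5,6) by (auto simp: public_data_def PiE_def Pi_def)
  then have "student (restrict DP S) \<in> (\<Pi>\<^sub>M _ \<in> S. count_space C) \<rightarrow>\<^sub>M N"
    using st unfolding measurable_student_def by blast
  then show h: "h \<in> (\<Pi>\<^sub>M i\<in>S \<times> C. borel) \<rightarrow>\<^sub>M N"
    unfolding h_def by (rule measurable_compose[OF measurable_votes_of_scores[OF assms(2,3)]])
  have noise: "vote_noise \<sigma> S C = (\<Pi>\<^sub>M i\<in>S \<times> C. gaussian \<sigma> 0)"
    by (simp add: vote_noise_def gaussian_def)
  have sh: "shift \<in> vote_noise \<sigma> S C \<rightarrow>\<^sub>M (\<Pi>\<^sub>M i\<in>S \<times> C. borel)"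
    unfolding shift_def noise by measurable
  have "distr (vote_noise \<sigma> S C) (\<Pi>\<^sub>M i\<in>S \<times> C. borel) shift = (\<Pi>\<^sub>M i\<in>S \<times> C. gaussian \<sigma> (v i))"
    unfolding noise shift_def
    by (subst PiM_distr) (simp_all add: assms prob_space_gaussian distr_gaussian_add)
  moreover have "student (restrict DP S) (ensemble_votes K T C S DP \<tau>) = h (shift \<tau>)" for \<tau>
    unfolding h_def ensemble_votes_def votes_of_scores_def noisy_vote_def
    by (intro arg_cong[where f = "student (restrict DP S)"] restrict_ext arg_max_on_cong)
      (simp add: shift_def v_def)
  ultimately show "sf_pate C K I train \<sigma> S N student DP DS =
      distr (\<Pi>\<^sub>M i\<in>S \<times> C. gaussian \<sigma> (real (vote_count K T (fst (DP (fst i))) (snd i)))) N h"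
    unfolding sf_pate_def T_def[symmetric] v_def[symmetric]
    using distr_distr[OF h sh] by (simp add: comp_def)
qed

section \<open>Sensitivity of the vote counts\<close>

text \<open>Teacher \<open>k0\<close> can only move its vote from \<open>T k0 x\<close> to
  \<open>T' k0 x\<close>, lowering one count by one and raising another by one. A \<open>k0\<close>
  outside \<open>{1..K}\<close> covers the case that no teacher changes.\<close>

lemma vote_count_sensitivity:
  fixes T T' :: "nat \<Rightarrow> 'x \<Rightarrow> 'c"
  assumes "finite C" and eq: "\<And>k. k \<in> {1..K} \<Longrightarrow> k \<noteq> k0 \<Longrightarrow> T k = T' k"
  shows "(\<Sum>c\<in>C. (real (vote_count K T x c) - real (vote_count K T' x c))\<^sup>2) \<le> 2"
proof -
  have split: "real (vote_count K U x c) = real (card {k \<in> {1..K} - {k0}. U k x = c})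
      + (if k0 \<in> {1..K} \<and> U k0 x = c then 1 else 0)" for U :: "nat \<Rightarrow> 'x \<Rightarrow> 'c" and c
  proof (cases "k0 \<in> {1..K} \<and> U k0 x = c")
    case True
    then have "{k \<in> {1..K}. U k x = c} = insert k0 {k \<in> {1..K} - {k0}. U k x = c}" by auto
    then show ?thesis using True by (simp add: vote_count_def)
  next
    case False
    then have "{k \<in> {1..K}. U k x = c} = {k \<in> {1..K} - {k0}. U k x = c}" by auto
    then show ?thesis using False by (simp add: vote_count_def)
  qed
  have "{k \<in> {1..K} - {k0}. T k x = c} = {k \<in> {1..K} - {k0}. T' k x = c}" for c
    using eq by auto
  \<comment> \<open>The contributions of the other teachers cancel, leaving the squared difference
    of two 0/1 indicators, or zero.\<close>
  then have "(real (vote_count K T x c) - real (vote_count K T' x c))\<^sup>2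
      \<le> (if c = T k0 x then 1 else 0) + (if c = T' k0 x then 1 else 0)" for c
    by (simp add: split)
  then have "(\<Sum>c\<in>C. (real (vote_count K T x c) - real (vote_count K T' x c))\<^sup>2)
      \<le> (\<Sum>c\<in>C. (if c = T k0 x then 1 else 0) + (if c = T' k0 x then 1 else 0))"
    by (intro sum_mono)
  also have "\<dots> \<le> 2"
    using assms(1) by (simp add: sum.distrib)
  finally show ?thesis .
qed

text \<open>The index with a changed attribute lies in at most one block by disjointness. Since all
  blocks lie in \<open>{1..n}\<close>, adjacency controls every attribute that a teacher
  sees.\<close>

lemma adjacent_changes_one_portion:
  assumes "adjacent n DS DS'" "disjoint_family_on I {1..K}" "(\<Union>k\<in>{1..K}. I k) = {1..n}"
  obtains k0 where "\<And>k. k \<in> {1..K} \<Longrightarrow> k \<noteq> k0 \<Longrightarrow> portion DP DS (I k) = portion DP DS' (I k)"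
proof -
  have "\<forall>i\<in>{j \<in> {1..n}. DS j \<noteq> DS' j}. \<forall>j\<in>{j \<in> {1..n}. DS j \<noteq> DS' j}. i = j"
    using assms(1) unfolding adjacent_def by (subst card_le_Suc0_iff_eq[symmetric]) auto
  \<comment> \<open>If no attribute changes, \<open>j0\<close> is arbitrary; likewise
    \<open>k0\<close> below if \<open>j0\<close> lies in no block.\<close>
  then obtain j0 where j0: "\<And>j. j \<in> {1..n} \<Longrightarrow> DS j \<noteq> DS' j \<Longrightarrow> j = j0"
    by blast
  obtain k0 where k0: "\<And>k. k \<in> {1..K} \<Longrightarrow> j0 \<in> I k \<Longrightarrow> k = k0"
    using assms(2) unfolding disjoint_family_on_def by blast
  show ?thesis
  proof (rule that)
    fix k assume k: "k \<in> {1..K}" "k \<noteq> k0"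
    have "DS j = DS' j" if "j \<in> I k" for j
      using that k k0 j0 assms(3) by blast
    then show "portion DP DS (I k) = portion DP DS' (I k)"
      by (auto simp: portion_def fun_eq_iff restrict_def)
  qed
qed

section \<open>The privacy guarantee\<close>

text \<open>Treats both algorithms at once, for any finite nonempty voting set
  \<open>C\<close>.\<close>

lemma sf_pate_dp:
  fixes C :: "'c set" and Y :: "'y set"
    and train :: "nat \<Rightarrow> (nat \<Rightarrow> 'x \<times> nat \<times> 'y) \<Rightarrow> 'x \<Rightarrow> 'c"
  assumes C: "finite C" "C \<noteq> {}"
    and I: "disjoint_family_on I {1..K}" "(\<Union>k\<in>{1..K}. I k) = {1..n}"
    and S: "S \<subseteq> {1..n}" and params: "0 < \<sigma>" "1 < \<gamma>" "0 < \<delta>"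
    and student: "measurable_student C Y S N student"
  shows "dp_wrt_group n m Y N (real (card S) * \<gamma> / \<sigma>\<^sup>2 + ln (1 / \<delta>) / (\<gamma> - 1)) \<delta>
    (sf_pate C K I train \<sigma> S N student)"
  unfolding dp_wrt_group_def
proof (intro ballI impI)
  fix DP :: "nat \<Rightarrow> 'x \<times> 'y" and DS DS' R
  assume DP: "DP \<in> public_data n Y" and adj: "adjacent n DS DS'" and R: "R \<in> sets N"
  have finS: "finite S" using S finite_subset by blast
  obtain k0 where k0: "\<And>k. k \<in> {1..K} \<Longrightarrow> k \<noteq> k0 \<Longrightarrow> portion DP DS (I k) = portion DP DS' (I k)"
    using adjacent_changes_one_portion[OF adj I] by metis
  define v where "v D i =
    real (vote_count K (\<lambda>k. train k (portion DP D (I k))) (fst (DP (fst i))) (snd i))"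
    for D and i :: "nat \<times> 'c"
  define h where "h u = student (restrict DP S) (votes_of_scores C S u)" for u
  have h: "h \<in> (\<Pi>\<^sub>M i\<in>S \<times> C. borel) \<rightarrow>\<^sub>M N"
    and distr: "sf_pate C K I train \<sigma> S N student DP D = distr (\<Pi>\<^sub>M i\<in>S \<times> C. gaussian \<sigma> (v D i)) N h" for D
    unfolding h_def v_def
    by (rule sf_pate_eq_distr_gaussian[OF params(1) C finS S DP student])+
  \<comment> \<open>The output event pulled back to the scores is the same set for both datasets, so
    the Gaussian bound can be applied to it.\<close>
  define B where "B = h -` R \<inter> space (\<Pi>\<^sub>M i\<in>S \<times> C. (borel :: real measure))"
  have B: "B \<in> sets (\<Pi>\<^sub>M i\<in>S \<times> C. borel)"
    unfolding B_def by (rule measurable_sets[OF h R])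
  have m: "measure (sf_pate C K I train \<sigma> S N student DP D) R = measure (\<Pi>\<^sub>M i\<in>S \<times> C. gaussian \<sigma> (v D i)) B" for D
  proof -
    have "h \<in> (\<Pi>\<^sub>M i\<in>S \<times> C. gaussian \<sigma> (v D i)) \<rightarrow>\<^sub>M N"
      using h by (simp cong: measurable_cong_sets sets_PiM_cong)
    then show ?thesis
      unfolding distr B_def using R by (simp add: measure_distr space_PiM)
  qed
  have "(\<Sum>i\<in>S \<times> C. (v DS i - v DS' i)\<^sup>2) = (\<Sum>j\<in>S. \<Sum>c\<in>C. (v DS (j, c) - v DS' (j, c))\<^sup>2)"
    by (simp add: sum.cartesian_product split_beta)
  \<comment> \<open>Both datasets share the public part, so each query is put to the two ensembles
    at the same features.\<close>
  also have "\<dots> \<le> (\<Sum>j\<in>S. 2)"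
  proof (rule sum_mono)
    fix j assume "j \<in> S"
    show "(\<Sum>c\<in>C. (v DS (j, c) - v DS' (j, c))\<^sup>2) \<le> 2"
      unfolding v_def fst_conv snd_conv using k0
      by (intro vote_count_sensitivity[OF C(1), where ?k0.0 = k0]) simp
  qed
  finally have sens: "(\<Sum>i\<in>S \<times> C. (v DS i - v DS' i)\<^sup>2) \<le> 2 * real (card S)" by simp
  show "measure (sf_pate C K I train \<sigma> S N student DP DS) R
      \<le> exp (real (card S) * \<gamma> / \<sigma>\<^sup>2 + ln (1 / \<delta>) / (\<gamma> - 1))
        * measure (sf_pate C K I train \<sigma> S N student DP DS') R + \<delta>"
    unfolding m using gaussian_mechanism_approx_dp[OF _ params sens B] finS C(1) by simp
qed

theorem mainTheorem7:
  fixes n m s K :: nat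
    and Y :: "'y set"
    and I :: "nat \<Rightarrow> nat set"
    and S :: "nat set"
    and \<sigma> \<gamma> \<delta> :: real
    and train\<^sub>S :: "nat \<Rightarrow> (nat \<Rightarrow> 'x \<times> nat \<times> 'y) \<Rightarrow> 'x \<Rightarrow> nat"
    and train\<^sub>T :: "nat \<Rightarrow> (nat \<Rightarrow> 'x \<times> nat \<times> 'y) \<Rightarrow> 'x \<Rightarrow> 'y"
    and N\<^sub>S :: "'p measure" and N\<^sub>T :: "'q measure"
    and student\<^sub>S :: "(nat \<Rightarrow> 'x \<times> 'y) \<Rightarrow> (nat \<Rightarrow> nat) \<Rightarrow> 'p"
    and student\<^sub>T :: "(nat \<Rightarrow> 'x \<times> 'y) \<Rightarrow> (nat \<Rightarrow> 'y) \<Rightarrow> 'q"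
  assumes "finite Y"
    and "disjoint_family_on I {1..K}" and "(\<Union>k\<in>{1..K}. I k) = {1..n}"
    and "S \<subseteq> {1..n}" and "card S = s" and "s \<ge> 1"
    and "\<sigma> > 0" and "\<gamma> > 1" and "0 < \<delta>" and "\<delta> < 1"
    and "teachers_into {1..m} m Y K I train\<^sub>S"
    and "teachers_into Y m Y K I train\<^sub>T"
    and "measurable_student {1..m} Y S N\<^sub>S student\<^sub>S"
    and "measurable_student Y Y S N\<^sub>T student\<^sub>T"
  shows "dp_wrt_group n m Y N\<^sub>S (real s * \<gamma> / \<sigma>\<^sup>2 + ln (1 / \<delta>) / (\<gamma> - 1)) \<delta>
           (sf_S_pate m K I train\<^sub>S \<sigma> S N\<^sub>S student\<^sub>S)
       \<and> dp_wrt_group n m Y N\<^sub>T (real s * \<gamma> / \<sigma>\<^sup>2 + ln (1 / \<delta>) / (\<gamma> - 1)) \<delta>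
           (sf_T_pate Y K I train\<^sub>T \<sigma> S N\<^sub>T student\<^sub>T)"
proof -
  \<comment> \<open>With at least one index, an empty attribute or label set leaves no dataset, so
    the privacy claim is vacuous exactly where the voting set would be empty.\<close>
  have "1 \<le> n"
    using assms(4-6) by (cases "n = 0") auto
  have S: "dp_wrt_group n m Y N\<^sub>S (real s * \<gamma> / \<sigma>\<^sup>2 + ln (1 / \<delta>) / (\<gamma> - 1)) \<delta>
      (sf_S_pate m K I train\<^sub>S \<sigma> S N\<^sub>S student\<^sub>S)"
  proof (cases "m = 0")
    case True
    then have "group_data n m = {}"
      using \<open>1 \<le> n\<close> by (auto simp: group_data_def PiE_eq_empty_iff)
    then show ?thesis by (simp add: dp_wrt_group_def)
  next
    case False
    then show ?thesis
      unfolding sf_S_pate_def assms(5)[symmetric] by (intro sf_pate_dp assms) auto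
  qed
  have T: "dp_wrt_group n m Y N\<^sub>T (real s * \<gamma> / \<sigma>\<^sup>2 + ln (1 / \<delta>) / (\<gamma> - 1)) \<delta>
      (sf_T_pate Y K I train\<^sub>T \<sigma> S N\<^sub>T student\<^sub>T)"
  proof (cases "Y = {}")
    case True
    then have "(public_data n Y :: (nat \<Rightarrow> 'x \<times> 'y) set) = {}"
      using \<open>1 \<le> n\<close> by (auto simp: public_data_def PiE_eq_empty_iff)
    then show ?thesis by (simp add: dp_wrt_group_def)
  next
    case False
    then show ?thesis
      unfolding sf_T_pate_def assms(5)[symmetric] by (intro sf_pate_dp assms)
  qed
  from S T show ?thesis by blast
qed

end
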